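(* For each partition $\lambda$, let $H_\lambda$ be an arbitrary (not necessarily connected) simple labelled graph on $\ell(\lambda)$ vertices. Then $\{X_{(H_\lambda, \lambda)}\}_{\lambda\vdash n\ge 0}$ is a basis for $\operatorname{Sym}$.
   Context: $\operatorname{Sym}\subseteq\mathbb{Q}[[x_1,x_2,\dots]]$ is the algebra of symmetric functions over $\mathbb{Q}$; the family is indexed by all partitions $\lambda=(\lambda_1\ge\dots\ge\lambda_{\ell(\lambda)})$ of all $n\ge0$ (for the empty partition, the graph is empty and the function is $1$). A simple graph has no loops and no multiple edges. A labelled graph has its vertices assigned an ordering $v_1,\dots,v_{N}$. For a labelled graph $H$ on $\ell(\lambda)$ vertices $v_1,\dots,v_{\ell(\lambda)}$, $(H,\lambda)$ is the weighted graph in which $v_i$ has weight $\lambda_i$. A proper colouring is a map $\kappa:V(H)\to\mathbb{Z}^+$ with $\kappa(u)\neq\kappa(v)$ whenever $uv$ is an edge, and the extended chromatic symmetric function is $X_{(H,\lambda)}=\sum_\kappa x_{\kappa(v_1)}^{\lambda_1}\cdots x_{\kappa(v_{\ell(\lambda)})}^{\lambda_{\ell(\lambda)}}$, summed over all proper colourings $\kappa$ of $H$. *)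

theory Defs
  imports Complex_Main "HOL-Library.Poly_Mapping" "HOL-Library.FuncSet"
begin

section \<open>Formal power series over the rationals in countably many variables\<close>

text \<open>
  The variables $x_1, x_2, \dots$ are indexed by \<^typ>\<open>nat\<close>, the index \<open>i\<close> standing for
  $x_{i+1}$; likewise the colour \<open>i\<close> stands for the positive integer \<open>i + 1\<close>.
  A monomial is given by its finitely supported exponent vector of type \<^typ>\<open>nat \<Rightarrow>\<^sub>0 nat\<close>,
  so that the product of monomials is the sum of exponent vectors.
\<close>

type_synonym monomial = "nat \<Rightarrow>\<^sub>0 nat"

typedef power_series = "UNIV :: (monomial \<Rightarrow> rat) set"
  morphisms coeff Abs_power_series
  by simp

setup_lifting type_definition_power_series

lemma power_series_eqI: "(\<And>m. coeff f m = coeff g m) \<Longrightarrow> f = g"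
  by (simp add: coeff_inject[symmetric] fun_eq_iff)

instantiation power_series :: ab_group_add
begin

lift_definition zero_power_series :: power_series is "\<lambda>_. 0" .
lift_definition plus_power_series :: "power_series \<Rightarrow> power_series \<Rightarrow> power_series"
  is "\<lambda>f g m. f m + g m" .
lift_definition minus_power_series :: "power_series \<Rightarrow> power_series \<Rightarrow> power_series"
  is "\<lambda>f g m. f m - g m" .
lift_definition uminus_power_series :: "power_series \<Rightarrow> power_series"
  is "\<lambda>f m. - f m" .

instance
  by standard (transfer; simp add: fun_eq_iff)+

end

lift_definition scale :: "rat \<Rightarrow> power_series \<Rightarrow> power_series"
  is "\<lambda>c f m. c * f m" .

lemma coeff_simps [simp]:
  "coeff 0 m = 0"
  "coeff (f + g) m = coeff f m + coeff g m"
  "coeff (f - g) m = coeff f m - coeff g m"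
  "coeff (- f) m = - coeff f m"
  "coeff (scale c f) m = c * coeff f m"
  by (transfer; simp)+

interpretation PS: vector_space scale
  by standard (rule power_series_eqI; simp add: algebra_simps)+


section \<open>Symmetric functions\<close>

definition total_degree :: "monomial \<Rightarrow> nat" where
  "total_degree m = (\<Sum>i\<in>Poly_Mapping.keys m. Poly_Mapping.lookup m i)"

text \<open>
  For a bijection \<open>\<pi>\<close>, the exponent of the variable \<open>i\<close> in \<^term>\<open>Poly_Mapping.map_key \<pi> m\<close> is
  the exponent of the variable \<open>\<pi> i\<close> in \<open>m\<close>.
\<close>

definition Sym :: "power_series set" where
  "Sym = {f. (\<exists>d. \<forall>m. coeff f m \<noteq> 0 \<longrightarrow> total_degree m \<le> d) \<and>
             (\<forall>\<pi> m. bij \<pi> \<longrightarrow> coeff f (Poly_Mapping.map_key \<pi> m) = coeff f m)}"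


section \<open>Partitions\<close>

definition partitions_of :: "nat \<Rightarrow> nat list set" where
  "partitions_of n = {lam. sorted_wrt (\<ge>) lam \<and> (\<forall>k\<in>set lam. k > 0) \<and> sum_list lam = n}"

definition partitions :: "nat list set" where
  "partitions = (\<Union>n. partitions_of n)"


section \<open>Labelled graphs and extended chromatic symmetric functions\<close>

text \<open>
  The list of vertices records the ordering: \<open>vertices H ! i\<close> is $v_{i+1}$.
\<close>

record 'v labelled_graph =
  vertices :: "'v list"
  edges :: "'v set set"

definition simple_labelled_graph :: "'v labelled_graph \<Rightarrow> bool" where
  "simple_labelled_graph H \<longleftrightarrow>
     distinct (vertices H) \<and> (\<forall>e\<in>edges H. e \<subseteq> set (vertices H) \<and> card e = 2)"

text \<open>Colourings are extensional, so that distinct colourings differ on some vertex.\<close>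

definition proper_colourings :: "'v labelled_graph \<Rightarrow> ('v \<Rightarrow> nat) set" where
  "proper_colourings H =
     {\<kappa> \<in> set (vertices H) \<rightarrow>\<^sub>E UNIV. \<forall>u v. {u, v} \<in> edges H \<longrightarrow> \<kappa> u \<noteq> \<kappa> v}"

definition colouring_monomial :: "'v labelled_graph \<Rightarrow> nat list \<Rightarrow> ('v \<Rightarrow> nat) \<Rightarrow> monomial" where
  "colouring_monomial H lam \<kappa> =
     (\<Sum>i<length lam. Poly_Mapping.single (\<kappa> (vertices H ! i)) (lam ! i))"

text \<open>
  The coefficient of a monomial in the formal sum over all proper colourings is the number of
  colourings contributing that monomial; \<open>finite_colourings_monomial\<close> below shows that this
  number is finite for positive weights.
\<close>

definition chromatic_sf :: "'v labelled_graph \<Rightarrow> nat list \<Rightarrow> power_series" where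
  "chromatic_sf H lam = Abs_power_series
     (\<lambda>m. of_nat (card {\<kappa> \<in> proper_colourings H. colouring_monomial H lam \<kappa> = m}))"

lemma finite_colourings_monomial:
  assumes len: "length (vertices H) = length lam" and pos: "\<forall>k\<in>set lam. k > 0"
  shows "finite {\<kappa> \<in> proper_colourings H. colouring_monomial H lam \<kappa> = m}"
proof (rule finite_subset)
  show "finite (set (vertices H) \<rightarrow>\<^sub>E Poly_Mapping.keys m)"
    by (intro finite_PiE) auto
  show "{\<kappa> \<in> proper_colourings H. colouring_monomial H lam \<kappa> = m}
      \<subseteq> set (vertices H) \<rightarrow>\<^sub>E Poly_Mapping.keys m"
  proof
    fix \<kappa> assume "\<kappa> \<in> {\<kappa> \<in> proper_colourings H. colouring_monomial H lam \<kappa> = m}"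
    then have k: "\<kappa> \<in> proper_colourings H" and m: "m = colouring_monomial H lam \<kappa>"
      by auto
    have "\<kappa> v \<in> Poly_Mapping.keys m" if v: "v \<in> set (vertices H)" for v
    proof -
      obtain i where i: "i < length lam" "vertices H ! i = v"
        using v len by (metis in_set_conv_nth)
      have "0 < Poly_Mapping.lookup (Poly_Mapping.single (\<kappa> (vertices H ! i)) (lam ! i)) (\<kappa> v)"
        using i pos by simp
      also have "\<dots> \<le> (\<Sum>j<length lam. Poly_Mapping.lookup
                       (Poly_Mapping.single (\<kappa> (vertices H ! j)) (lam ! j)) (\<kappa> v))"
        using i by (intro member_le_sum) auto
      also have "\<dots> = Poly_Mapping.lookup m (\<kappa> v)"
        by (simp add: m colouring_monomial_def lookup_sum)
      finally show ?thesis by (simp add: in_keys_iff)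
    qed
    with k show "\<kappa> \<in> set (vertices H) \<rightarrow>\<^sub>E Poly_Mapping.keys m"
      by (auto simp: proper_colourings_def PiE_iff)
  qed
qed

end

theory Submission
  imports Defs "HOL-Library.Multiset" "HOL-Library.Infinite_Set"
begin

text \<open>
  If the monomial $x_1^{\mu_1} x_2^{\mu_2} \cdots$ occurs in $X_{(H_\lambda,\lambda)}$, then a
  colouring merges the parts of $\lambda$ into the parts of $\mu$, so either $\mu = \lambda$ or
  $\mu$ is strictly shorter than $\lambda$; and it does occur for $\mu = \lambda$, because an
  injective colouring is proper for every graph. The transition matrix to the monomial basis is
  therefore triangular with nonzero diagonal, with respect to the number of parts.
\<close>

section \<open>Partitions as exponent vectors, degrees and finiteness\<close>

text \<open>For \<open>f\<close> in \<open>Sym\<close>, the coefficient at this monomial is the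
  coordinate of \<open>f\<close> at the monomial symmetric function of \<open>lam\<close>. Working
  with these coefficients replaces that basis.\<close>

definition partition_monomial :: "nat list \<Rightarrow> monomial" where
  "partition_monomial lam = (\<Sum>i<length lam. Poly_Mapping.single i (lam ! i))"

lemma lookup_partition_monomial:
  "Poly_Mapping.lookup (partition_monomial lam) j = (if j < length lam then lam ! j else 0)"
  by (auto simp: partition_monomial_def lookup_sum lookup_single when_def)

lemma lookup_colouring_monomial:
  "Poly_Mapping.lookup (colouring_monomial H lam \<kappa>) j =
     (\<Sum>i<length lam. if \<kappa> (vertices H ! i) = j then lam ! i else 0)"
  by (auto simp: colouring_monomial_def lookup_sum lookup_single when_def)

lemma partitions_iff:
  "lam \<in> partitions \<longleftrightarrow> sorted_wrt (\<ge>) lam \<and> (\<forall>k\<in>set lam. k > 0)"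
  by (auto simp: partitions_def partitions_of_def)

lemma keys_partition_monomial:
  assumes "lam \<in> partitions"
  shows "Poly_Mapping.keys (partition_monomial lam) = {..<length lam}"
  using assms unfolding set_eq_iff in_keys_iff lookup_partition_monomial
  by (simp add: partitions_iff)

lemma total_degree_partition_monomial:
  assumes "lam \<in> partitions"
  shows "total_degree (partition_monomial lam) = sum_list lam"
  by (simp add: total_degree_def keys_partition_monomial[OF assms] lookup_partition_monomial
      sum_list_sum_nth atLeast0LessThan)

lemma total_degree_colouring_monomial_le:
  "total_degree (colouring_monomial H lam \<kappa>) \<le> sum_list lam"
proof -
  let ?K = "Poly_Mapping.keys (colouring_monomial H lam \<kappa>)"
  have "total_degree (colouring_monomial H lam \<kappa>) =
      (\<Sum>i<length lam. \<Sum>j\<in>?K. if \<kappa> (vertices H ! i) = j then lam ! i else 0)"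
    unfolding total_degree_def lookup_colouring_monomial by (rule sum.swap)
  \<comment> \<open>Vertex \<open>i\<close> contributes at a single index, its own colour, so the
    inner sum is \<open>lam ! i\<close> or 0.\<close>
  also have "\<dots> \<le> (\<Sum>i<length lam. lam ! i)"
    by (intro sum_mono) simp
  finally show ?thesis
    by (simp add: sum_list_sum_nth atLeast0LessThan)
qed

lemma length_le_sum_list:
  "\<forall>k\<in>set lam. k > 0 \<Longrightarrow> length lam \<le> sum_list (lam :: nat list)"
  by (induction lam) fastforce+

text \<open>Since parts are positive, \<open>d\<close> bounds both the parts and their number. The
  spanning argument subtracts sums over subsets of this set.\<close>

lemma finite_partitions_le: "finite {lam \<in> partitions. sum_list lam \<le> d}"
proof (rule finite_subset)
  show "finite {xs. set xs \<subseteq> {..d} \<and> length xs \<le> d}"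
    by (intro finite_lists_length_le) simp
  show "{lam \<in> partitions. sum_list lam \<le> d} \<subseteq> {xs. set xs \<subseteq> {..d} \<and> length xs \<le> d}"
  proof clarify
    fix lam assume lam: "lam \<in> partitions" "sum_list lam \<le> d"
    then have "length lam \<le> d"
      using length_le_sum_list[of lam] by (simp add: partitions_iff)
    moreover have "k \<le> d" if "k \<in> set lam" for k
      using member_le_sum_list[OF that] lam(2) by simp
    ultimately show "set lam \<subseteq> {..d} \<and> length lam \<le> d"
      by (simp add: subset_iff)
  qed
qed

section \<open>Orbits of monomials under permutations of the variables\<close>

text \<open>Both complements are infinite sets of naturals, hence in bijection through their
  enumerations; this bijection is glued to the finite one.\<close>

lemma bij_extend_nth:
  fixes xs :: "nat list"
  assumes "distinct xs"
  obtains \<pi> where "bij \<pi>" "\<And>i. i < length xs \<Longrightarrow> \<pi> i = xs ! i"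
proof -
  have "infinite (- {..<length xs})" "infinite (- set xs)"
    by (simp_all add: infinite_Ici finite_compl)
  then have "bij_betw (Infinite_Set.enumerate (- {..<length xs})) UNIV (- {..<length xs})"
    "bij_betw (Infinite_Set.enumerate (- set xs)) UNIV (- set xs)"
    by (simp_all add: bij_enumerate)
  then obtain g where g: "bij_betw g (- {..<length xs}) (- set xs)"
    by (meson bij_betw_inv bij_betw_trans)
  define \<pi> where "\<pi> i = (if i \<in> {..<length xs} then xs ! i else g i)" for i
  have "bij_betw \<pi> {..<length xs} (set xs)"
    using bij_betw_nth[OF assms refl refl] by (rule bij_betw_cong[THEN iffD1, rotated]) (simp add: \<pi>_def)
  moreover have "bij_betw \<pi> (- {..<length xs}) (- set xs)"
    using g by (rule bij_betw_cong[THEN iffD1, rotated]) (simp add: \<pi>_def)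
  ultimately have "bij_betw \<pi> ({..<length xs} \<union> - {..<length xs}) (set xs \<union> - set xs)"
    by (rule bij_betw_combine) simp
  then have "bij \<pi>"
    unfolding Compl_partition .
  then show thesis
    by (rule that) (simp add: \<pi>_def)
qed

text \<open>List the support by decreasing exponent and let \<open>\<pi>\<close> send 0, 1, ... to
  the listed variables: the exponents read along \<open>\<pi>\<close> form a partition.\<close>

lemma monomial_permutes_to_partition:
  fixes m :: monomial
  obtains \<pi> lam where "bij \<pi>" "lam \<in> partitions"
    "Poly_Mapping.map_key \<pi> m = partition_monomial lam"
proof -
  define xs where
    "xs = rev (sort_key (Poly_Mapping.lookup m) (sorted_list_of_set (Poly_Mapping.keys m)))"
  define lam where "lam = map (Poly_Mapping.lookup m) xs"
  have xs: "distinct xs" "set xs = Poly_Mapping.keys m"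
    by (simp_all add: xs_def)
  obtain \<pi> where \<pi>: "bij \<pi>" "\<And>i. i < length xs \<Longrightarrow> \<pi> i = xs ! i"
    using bij_extend_nth[OF xs(1)] by blast
  have "sorted_wrt (\<ge>) lam"
    unfolding lam_def xs_def rev_map[symmetric] sorted_wrt_rev by simp
  then have "lam \<in> partitions"
    using xs(2)
    by (auto simp: partitions_iff lam_def simp flip: lookup_not_eq_zero_eq_in_keys)
  moreover have "Poly_Mapping.map_key \<pi> m = partition_monomial lam"
  proof (rule poly_mapping_eqI)
    fix i
    \<comment> \<open>The initial indices already exhaust the support, so by injectivity later ones
      are sent outside it.\<close>
    have "Poly_Mapping.lookup m (\<pi> i) = 0" if "\<not> i < length xs"
    proof (rule ccontr)
      assume "Poly_Mapping.lookup m (\<pi> i) \<noteq> 0"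
      then obtain j where "j < length xs" "\<pi> i = xs ! j"
        using xs(2) by (metis in_keys_iff in_set_conv_nth)
      then show False
        using \<pi>(2) bij_is_inj[OF \<pi>(1)] that by (metis injD)
    qed
    then show "Poly_Mapping.lookup (Poly_Mapping.map_key \<pi> m) i =
        Poly_Mapping.lookup (partition_monomial lam) i"
      using \<pi> by (auto simp: lookup_partition_monomial lam_def map_key.rep_eq bij_is_inj)
  qed
  ultimately show thesis
    using \<pi>(1) that by blast
qed

text \<open>Coefficients are constant on orbits, and every orbit contains a
  \<open>partition_monomial\<close>.\<close>

lemma Sym_eq_0I:
  assumes "f \<in> Sym" "\<And>lam. lam \<in> partitions \<Longrightarrow> coeff f (partition_monomial lam) = 0"
  shows "f = 0"
proof (rule power_series_eqI)
  fix m :: monomial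
  obtain \<pi> lam where \<pi>: "bij \<pi>" "lam \<in> partitions"
    "Poly_Mapping.map_key \<pi> m = partition_monomial lam"
    by (rule monomial_permutes_to_partition)
  have "coeff f m = coeff f (Poly_Mapping.map_key \<pi> m)"
    using assms(1) \<pi>(1) by (simp add: Sym_def)
  then show "coeff f m = coeff 0 m"
    using assms(2)[OF \<pi>(2)] \<pi>(3) by simp
qed

section \<open>Triangular families in the space of symmetric functions\<close>

lemma subspace_Sym: "PS.subspace Sym"
proof (rule PS.subspaceI)
  show "0 \<in> Sym" by (simp add: Sym_def)
next
  fix f g assume f: "f \<in> Sym" and g: "g \<in> Sym"
  obtain d e where "\<forall>m. coeff f m \<noteq> 0 \<longrightarrow> total_degree m \<le> d"
    "\<forall>m. coeff g m \<noteq> 0 \<longrightarrow> total_degree m \<le> e"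
    using f g by (auto simp: Sym_def)
  then have "\<forall>m. coeff (f + g) m \<noteq> 0 \<longrightarrow> total_degree m \<le> max d e"
    by (metis add.right_neutral coeff_simps(2) max.coboundedI1 max.coboundedI2)
  then show "f + g \<in> Sym"
    using f g unfolding Sym_def by (auto simp del: neq0_conv)
next
  fix c f assume "f \<in> Sym"
  then show "scale c f \<in> Sym" by (auto simp: Sym_def)
qed

lemma coeff_sum: "coeff (sum f A) m = (\<Sum>a\<in>A. coeff (f a) m)"
  by (induction A rule: infinite_finite_induct) auto

text \<open>Distinct partitions of equal length do not interact, so length alone can order the
  elimination. Independence looks at a longest partition involved; spanning eliminates from the
  longest partitions downwards, with \<open>degree\<close> keeping each stage within a fixed degree
  bound.\<close>

lemma Sym_basis_if_triangular:
  assumes X_Sym: "\<And>lam. lam \<in> partitions \<Longrightarrow> X lam \<in> Sym"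
    and degree: "\<And>lam m. lam \<in> partitions \<Longrightarrow> coeff (X lam) m \<noteq> 0 \<Longrightarrow>
      total_degree m \<le> sum_list lam"
    and diag: "\<And>lam. lam \<in> partitions \<Longrightarrow> coeff (X lam) (partition_monomial lam) \<noteq> 0"
    and triangular: "\<And>lam mu. lam \<in> partitions \<Longrightarrow> mu \<in> partitions \<Longrightarrow> mu \<noteq> lam \<Longrightarrow>
      length lam \<le> length mu \<Longrightarrow> coeff (X lam) (partition_monomial mu) = 0"
  shows "inj_on X partitions \<and> PS.independent (X ` partitions) \<and> PS.span (X ` partitions) = Sym"
proof -
  have inj: "inj_on X partitions"
  proof (rule inj_onI, rule ccontr)
    fix lam mu assume "lam \<in> partitions" "mu \<in> partitions" "X lam = X mu" "lam \<noteq> mu"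
    \<comment> \<open>At the monomial of the longer partition (either one, if the lengths agree),
      one of the two equal series vanishes and the other does not.\<close>
    then show False
      using diag triangular by (metis nle_le)
  qed

  have indep: "PS.independent (X ` partitions)"
  proof
    assume "PS.dependent (X ` partitions)"
    then obtain T u where T: "finite T" "T \<subseteq> X ` partitions"
      and sum0: "(\<Sum>v\<in>T. scale (u v) v) = 0" and nz: "\<exists>v\<in>T. u v \<noteq> 0"
      unfolding PS.dependent_explicit by auto
    obtain L where L: "L \<subseteq> partitions" "inj_on X L" "T = X ` L"
      using T(2) by (auto simp: subset_image_inj)
    define N where "N = {lam \<in> L. u (X lam) \<noteq> 0}"
    have "finite L" "finite N" "N \<noteq> {}"
      using T(1) L nz by (auto simp: N_def finite_image_iff)
    then have "Max (length ` N) \<in> length ` N"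
      by (intro Max_in) simp_all
    then obtain mu where mu: "mu \<in> N" and "length mu = Max (length ` N)"
      by (elim imageE) (rule that, simp_all)
    then have maximal: "length lam \<le> length mu" if "lam \<in> N" for lam
      using that \<open>finite N\<close> by simp
    \<comment> \<open>In the coefficient at a longest \<open>mu\<close> of \<open>N\<close>, every
      other term vanishes: either its scalar is 0 or its partition is no longer than
      \<open>mu\<close>.\<close>
    have "0 = (\<Sum>lam\<in>L. u (X lam) * coeff (X lam) (partition_monomial mu))"
      using arg_cong[OF sum0, of "\<lambda>f. coeff f (partition_monomial mu)"]
      by (simp add: coeff_sum L(3) sum.reindex[OF L(2)])
    also have "\<dots> = (\<Sum>lam\<in>{mu}. u (X lam) * coeff (X lam) (partition_monomial mu))"
    proof (rule sum.mono_neutral_right)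
      show "\<forall>lam\<in>L - {mu}. u (X lam) * coeff (X lam) (partition_monomial mu) = 0"
        using maximal triangular L(1) mu by (auto simp: N_def subset_iff)
    qed (use \<open>finite L\<close> mu in \<open>auto simp: N_def\<close>)
    finally show False
      using mu diag L(1) by (auto simp: N_def)
  qed

  \<comment> \<open>Induction on a strict bound \<open>k\<close> for the lengths of the partitions
    at which \<open>f\<close> has a nonzero coefficient; the degree bound \<open>d\<close> stays
    fixed.\<close>
  have spanning: "f \<in> PS.span (X ` partitions)"
    if "f \<in> Sym" "\<And>m. coeff f m \<noteq> 0 \<Longrightarrow> total_degree m \<le> d"
      "\<And>mu. mu \<in> partitions \<Longrightarrow> k \<le> length mu \<Longrightarrow> coeff f (partition_monomial mu) = 0" for f d k
    using that
  proof (induction k arbitrary: f)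
    case 0
    then have "f = 0"
      by (intro Sym_eq_0I) auto
    then show ?case
      by (simp add: PS.span_zero)
  next
    case (Suc k)
    \<comment> \<open>The longest partitions that can still occur in \<open>f\<close> have length
      exactly \<open>k\<close>. Dividing by the diagonal coefficient makes \<open>g\<close> agree
      with \<open>f\<close> there, so \<open>f - g\<close> satisfies the bound
      \<open>k\<close>.\<close>
    define P where "P = {lam \<in> partitions. sum_list lam \<le> d \<and> length lam = k}"
    define a where
      "a lam = coeff f (partition_monomial lam) / coeff (X lam) (partition_monomial lam)" for lam
    define g where "g = (\<Sum>lam\<in>P. scale (a lam) (X lam))"
    have "finite P"
      by (rule finite_subset[OF _ finite_partitions_le[of d]]) (auto simp: P_def)
    have g_span: "g \<in> PS.span (X ` partitions)"
      unfolding g_def by (intro PS.span_sum PS.span_scale PS.span_base) (auto simp: P_def)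
    have "f - g \<in> PS.span (X ` partitions)"
    proof (rule Suc.IH)
      show "f - g \<in> Sym"
        unfolding g_def using subspace_Sym Suc.prems(1) X_Sym
        by (intro PS.subspace_diff PS.subspace_sum PS.subspace_scale) (auto simp: P_def)
    next
      fix m assume nz: "coeff (f - g) m \<noteq> 0"
      show "total_degree m \<le> d"
      proof (rule ccontr)
        assume deg: "\<not> total_degree m \<le> d"
        then have "coeff (X lam) m = 0" if "lam \<in> P" for lam
          using that degree[of lam m] by (force simp: P_def)
        then have "coeff g m = 0"
          by (simp add: g_def coeff_sum)
        then show False
          using nz deg Suc.prems(2) by auto
      qed
    next
      fix mu assume mu: "mu \<in> partitions" "k \<le> length mu"
      \<comment> \<open>Each \<open>lam\<close> in \<open>P\<close> has length \<open>k\<close>, at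
        most that of \<open>mu\<close>, so only \<open>lam = mu\<close> contributes.\<close>
      have "coeff g (partition_monomial mu) =
          (\<Sum>lam\<in>P. if lam = mu then coeff f (partition_monomial mu) else 0)"
        unfolding g_def coeff_sum
        using mu triangular diag by (intro sum.cong) (auto simp: P_def a_def)
      \<comment> \<open>no\<close>
      also have "\<dots> = (if mu \<in> P then coeff f (partition_monomial mu) else 0)"
        using \<open>finite P\<close> by simp
      also have "\<dots> = coeff f (partition_monomial mu)"
        using mu Suc.prems(2)[of "partition_monomial mu"] Suc.prems(3)[of mu]
        by (auto simp: P_def total_degree_partition_monomial)
      finally show "coeff (f - g) (partition_monomial mu) = 0"
        by simp
    qed
    then show ?case
      using PS.span_add[OF _ g_span] by fastforce
  qed

  have "PS.span (X ` partitions) = Sym"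
  proof
    show "PS.span (X ` partitions) \<subseteq> Sym"
      using X_Sym by (intro PS.span_minimal subspace_Sym) auto
    show "Sym \<subseteq> PS.span (X ` partitions)"
    proof
      fix f assume f: "f \<in> Sym"
      then obtain d where d: "\<And>m. coeff f m \<noteq> 0 \<Longrightarrow> total_degree m \<le> d"
        by (auto simp: Sym_def)
      have "coeff f (partition_monomial mu) = 0" if "mu \<in> partitions" "Suc d \<le> length mu" for mu
        using that d[of "partition_monomial mu"] length_le_sum_list[of mu]
        by (force simp: total_degree_partition_monomial partitions_iff)
      then show "f \<in> PS.span (X ` partitions)"
        using f d by (intro spanning[of f d "Suc d"])
    qed
  qed
  with inj indep show ?thesis
    by blast
qed

lemma coeff_chromatic_sf:
  "coeff (chromatic_sf H lam) m =
     of_nat (card {\<kappa> \<in> proper_colourings H. colouring_monomial H lam \<kappa> = m})"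
  by (simp add: chromatic_sf_def Abs_power_series_inverse)

lemma coeff_chromatic_sf_nonzeroE:
  assumes "coeff (chromatic_sf H lam) m \<noteq> 0"
  obtains \<kappa> where "\<kappa> \<in> proper_colourings H" "colouring_monomial H lam \<kappa> = m"
proof -
  have "{\<kappa> \<in> proper_colourings H. colouring_monomial H lam \<kappa> = m} \<noteq> {}"
    using assms unfolding coeff_chromatic_sf
    by (rule contrapos_nn) (simp only: card.empty of_nat_0)
  then show thesis using that by blast
qed

lemma chromatic_sf_degree_le:
  assumes "coeff (chromatic_sf H lam) m \<noteq> 0"
  shows "total_degree m \<le> sum_list lam"
  using assms total_degree_colouring_monomial_le by (metis coeff_chromatic_sf_nonzeroE)

lemma coeff_chromatic_sf_diagonal:
  assumes H: "simple_labelled_graph H" and len: "length (vertices H) = length lam"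
    and lam: "lam \<in> partitions"
  shows "coeff (chromatic_sf H lam) (partition_monomial lam) \<noteq> 0"
proof -
  let ?V = "set (vertices H)" and ?ix = "the_inv_into {..<length lam} ((!) (vertices H))"
  have "inj_on ((!) (vertices H)) {..<length lam}"
    using H len by (auto simp: simple_labelled_graph_def inj_on_def nth_eq_iff_index_eq)
  then have bij: "bij_betw ((!) (vertices H)) {..<length lam} ?V"
    using len by (simp add: bij_betw_def set_conv_nth lessThan_def image_Collect Setcompr_eq_image)
  define \<kappa> where "\<kappa> = restrict ?ix ?V"
  have \<kappa>: "\<kappa> (vertices H ! i) = i" if "i < length lam" for i
    using that bij len by (simp add: \<kappa>_def the_inv_into_f_f bij_betw_def)
  have inj: "inj_on \<kappa> ?V"
    using bij_betw_the_inv_into[OF bij] by (simp add: \<kappa>_def bij_betw_def)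
  have "\<kappa> u \<noteq> \<kappa> v" if "{u, v} \<in> edges H" for u v
  proof -
    have "{u, v} \<subseteq> ?V" "card {u, v} = 2"
      using H that by (auto simp: simple_labelled_graph_def)
    then have "u \<in> ?V" "v \<in> ?V" "u \<noteq> v"
      by auto
    then show ?thesis
      using inj by (simp add: inj_on_eq_iff)
  qed
  then have "\<kappa> \<in> proper_colourings H"
    by (auto simp: proper_colourings_def \<kappa>_def)
  moreover have "colouring_monomial H lam \<kappa> = partition_monomial lam"
    by (simp add: colouring_monomial_def partition_monomial_def \<kappa>)
  moreover have "finite {\<kappa> \<in> proper_colourings H. colouring_monomial H lam \<kappa> = partition_monomial lam}"
    using finite_colourings_monomial[OF len] lam by (simp add: partitions_iff)
  ultimately show ?thesis
    by (auto simp: coeff_chromatic_sf)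
qed

lemma recolour_proper_colouring:
  assumes "simple_labelled_graph H" "inj \<pi>" "\<kappa> \<in> proper_colourings H"
  shows "restrict (\<pi> \<circ> \<kappa>) (set (vertices H)) \<in> proper_colourings H"
proof -
  have "\<kappa> u \<noteq> \<kappa> v" if "{u, v} \<in> edges H" for u v
    using assms(3) that by (simp add: proper_colourings_def)
  moreover have "\<forall>e\<in>edges H. e \<subseteq> set (vertices H)"
    using assms(1) by (simp add: simple_labelled_graph_def)
  then have "u \<in> set (vertices H)" "v \<in> set (vertices H)" if "{u, v} \<in> edges H" for u v
    by (auto dest: bspec[OF _ that])
  ultimately show ?thesis
    by (simp add: proper_colourings_def inj_eq[OF assms(2)])
qed

lemma recolour_monomial:
  assumes "length (vertices H) = length lam" "bij \<pi>"
  shows "colouring_monomial H lam (restrict (\<pi> \<circ> \<kappa>) (set (vertices H))) = m \<longleftrightarrow>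
    colouring_monomial H lam \<kappa> = Poly_Mapping.map_key \<pi> m"
proof -
  have "Poly_Mapping.lookup (colouring_monomial H lam (restrict (\<pi> \<circ> \<kappa>) (set (vertices H)))) (\<pi> j) =
      Poly_Mapping.lookup (colouring_monomial H lam \<kappa>) j" for j
    using assms by (auto simp: lookup_colouring_monomial bij_is_inj inj_eq intro!: sum.cong)
  moreover have "m' = m'' \<longleftrightarrow> (\<forall>j. Poly_Mapping.lookup m' (\<pi> j) = Poly_Mapping.lookup m'' (\<pi> j))"
    for m' m'' :: monomial
    unfolding poly_mapping_eq_iff fun_eq_iff using assms(2) by (metis bij_pointE)
  ultimately show ?thesis
    using assms(2) by (auto simp: poly_mapping_eq_iff fun_eq_iff map_key.rep_eq bij_is_inj)
qed

lemma chromatic_sf_in_Sym: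
  assumes H: "simple_labelled_graph H" and len: "length (vertices H) = length lam"
  shows "chromatic_sf H lam \<in> Sym"
proof -
  have "coeff (chromatic_sf H lam) (Poly_Mapping.map_key \<pi> m) = coeff (chromatic_sf H lam) m"
    if \<pi>: "bij \<pi>" for \<pi> m
  proof -
    let ?V = "set (vertices H)"
    have \<pi>': "inj \<pi>" "inj (inv \<pi>)" "\<And>x. inv \<pi> (\<pi> x) = x" "\<And>x. \<pi> (inv \<pi> x) = x"
      using \<pi> by (auto simp: bij_is_inj bij_is_surj bij_imp_bij_inv surj_f_inv_f)
    have restrict: "restrict \<kappa> ?V = \<kappa>" if "\<kappa> \<in> proper_colourings H" for \<kappa>
      using that unfolding proper_colourings_def by (elim CollectE conjE) (rule PiE_restrict)
    have inv: "restrict (inv \<pi> \<circ> restrict (\<pi> \<circ> \<kappa>) ?V) ?V = restrict \<kappa> ?V"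
      "restrict (\<pi> \<circ> restrict (inv \<pi> \<circ> \<kappa>) ?V) ?V = restrict \<kappa> ?V" for \<kappa>
      by (rule restrict_ext, simp add: \<pi>'(3,4))+
    have "bij_betw (\<lambda>\<kappa>. restrict (\<pi> \<circ> \<kappa>) ?V)
      {\<kappa> \<in> proper_colourings H. colouring_monomial H lam \<kappa> = Poly_Mapping.map_key \<pi> m}
      {\<kappa> \<in> proper_colourings H. colouring_monomial H lam \<kappa> = m}"
    proof (rule bij_betw_byWitness[where f' = "\<lambda>\<kappa>. restrict (inv \<pi> \<circ> \<kappa>) ?V"])
      show "(\<lambda>\<kappa>. restrict (\<pi> \<circ> \<kappa>) ?V) `
          {\<kappa> \<in> proper_colourings H. colouring_monomial H lam \<kappa> = Poly_Mapping.map_key \<pi> m} \<subseteq>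
        {\<kappa> \<in> proper_colourings H. colouring_monomial H lam \<kappa> = m}"
        by (simp add: image_subset_iff recolour_proper_colouring[OF H \<pi>'(1)]
            recolour_monomial[OF len \<pi>])
      show "(\<lambda>\<kappa>. restrict (inv \<pi> \<circ> \<kappa>) ?V) `
          {\<kappa> \<in> proper_colourings H. colouring_monomial H lam \<kappa> = m} \<subseteq>
        {\<kappa> \<in> proper_colourings H. colouring_monomial H lam \<kappa> = Poly_Mapping.map_key \<pi> m}"
        by (simp add: image_subset_iff recolour_proper_colouring[OF H \<pi>'(2)] inv(2) restrict
            flip: recolour_monomial[OF len \<pi>])
    qed (simp_all add: inv restrict)
    then show ?thesis
      by (simp add: coeff_chromatic_sf bij_betw_same_card)
  qed
  then show ?thesis
    unfolding Sym_def using chromatic_sf_degree_le by blast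
qed

lemma coeff_chromatic_sf_triangular:
  assumes len: "length (vertices H) = length lam"
    and lam: "lam \<in> partitions" and mu: "mu \<in> partitions"
    and nz: "coeff (chromatic_sf H lam) (partition_monomial mu) \<noteq> 0"
  shows "mu = lam \<or> length mu < length lam"
proof -
  obtain \<kappa> where \<kappa>: "colouring_monomial H lam \<kappa> = partition_monomial mu"
    using nz by (rule coeff_chromatic_sf_nonzeroE)
  define c where "c i = \<kappa> (vertices H ! i)" for i
  have mu_eq: "(if j < length mu then mu ! j else 0) =
      (\<Sum>i<length lam. if c i = j then lam ! i else 0)" for j
    using lookup_colouring_monomial[of H lam \<kappa> j]
    by (simp add: \<kappa> lookup_partition_monomial c_def)
  have image: "c ` {..<length lam} = {..<length mu}"
  proof (intro set_eqI)
    fix j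
    have "j < length mu \<longleftrightarrow> (if j < length mu then mu ! j else 0) \<noteq> 0"
      using mu by (simp add: partitions_iff)
    also have "\<dots> \<longleftrightarrow> (\<exists>i<length lam. c i = j)"
      using lam unfolding mu_eq by (auto simp: partitions_iff)
    finally show "j \<in> c ` {..<length lam} \<longleftrightarrow> j \<in> {..<length mu}"
      by auto
  qed
  show ?thesis
  proof (cases "length mu < length lam")
    case False
    have "length mu \<le> length lam"
      using card_image_le[of "{..<length lam}" c] image by simp
    then have len_eq: "length mu = length lam"
      using False by simp
    then have inj: "inj_on c {..<length lam}"
      using image by (intro eq_card_imp_inj_on) simp_all
    have nth: "mu ! c i = lam ! i" if i: "i < length lam" for i
    proof -
      have "c i < length mu"
        using image i by blast
      then have "mu ! c i = (\<Sum>k<length lam. if c k = c i then lam ! k else 0)"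
        using mu_eq[of "c i"] by simp
      also have "\<dots> = (\<Sum>k<length lam. if k = i then lam ! k else 0)"
        using inj i by (intro sum.cong) (auto simp: inj_on_def)
      finally show ?thesis
        using i by simp
    qed
    have mset_nth: "mset xs = image_mset ((!) xs) (mset_set {..<length xs})" for xs :: "nat list"
      by (metis map_nth mset_map mset_upt atLeast0LessThan)
    have "mset mu = image_mset ((!) mu) (image_mset c (mset_set {..<length lam}))"
      using inj image by (simp add: mset_nth[of mu] image_mset_mset_set)
    also have "\<dots> = mset lam"
      using nth by (auto simp: mset_nth[of lam] multiset.map_comp intro!: image_mset_cong)
    finally have "mset (rev mu) = mset (rev lam)"
      by simp
    moreover have "sorted (rev mu)" "sorted (rev lam)"
      using lam mu by (simp_all add: partitions_iff sorted_wrt_rev)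
    ultimately have "rev mu = rev lam"
      by (metis properties_for_sort)
    then show ?thesis
      by simp
  qed simp
qed

theorem theorem5p5:
  fixes H :: "nat list \<Rightarrow> 'v labelled_graph"
  assumes "\<And>lam. lam \<in> partitions \<Longrightarrow>
             simple_labelled_graph (H lam) \<and> length (vertices (H lam)) = length lam"
  shows "inj_on (\<lambda>lam. chromatic_sf (H lam) lam) partitions \<and>
         PS.independent ((\<lambda>lam. chromatic_sf (H lam) lam) ` partitions) \<and>
         PS.span ((\<lambda>lam. chromatic_sf (H lam) lam) ` partitions) = Sym"
proof (rule Sym_basis_if_triangular)
  fix lam mu assume "lam \<in> partitions" "mu \<in> partitions" "mu \<noteq> lam" "length lam \<le> length mu"
  then show "coeff (chromatic_sf (H lam) lam) (partition_monomial mu) = 0"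
    using coeff_chromatic_sf_triangular[of "H lam" lam mu] assms[of lam] by linarith
qed (simp_all add: assms chromatic_sf_in_Sym coeff_chromatic_sf_diagonal chromatic_sf_degree_le)

end
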